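(* Let $r$ be either a positive integer or $r=\infty$, let $Y\subset\mathbb{R}^n$ be a weakly $\mathscr{C}^r$ triangulable set and let $y_0\in Y$. We have: (i) Each continuous path $\gamma:[0,1]\to Y$ can be approximated in the strong $\mathscr{C}^0$ topology by $\mathscr{C}^r$ paths $\alpha:[0,1]\to Y$ such that $\alpha(0)=\gamma(0)$ and $\alpha(1)=\gamma(1)$. (ii) For each integer $p\geq1$, every element of $\pi_p(Y,y_0)$ can be represented by a $\mathscr{C}^r$ map.
   Context: All subsets of Euclidean spaces carry the relative Euclidean topology; $\mathbb{R}^+:=\{t\in\mathbb{R}: t>0\}$. For $X\subset\mathbb{R}^m$ locally compact and $Y\subset\mathbb{R}^n$, a map $g:X\to Y$ is a $\mathscr{C}^r$ map if there exist an open neighborhood $U\subset\mathbb{R}^m$ of $X$ (in which $X$ is closed) and a map $G:U\to\mathbb{R}^n$ of class $\mathscr{C}^r$ in the standard sense such that $g(x)=G(x)$ for each $x\in X$. The strong (Whitney) $\mathscr{C}^0$ topology on the set $\mathscr{C}^0(X,Y)$ of continuous maps has as fundamental system of neighborhoods of $f$ the sets $\{g\in\mathscr{C}^0(X,Y): \|g(x)-f(x)\|_n<\varepsilon(x)\ \forall x\in X\}$, where $\|\cdot\|_n$ is the Euclidean norm and $\varepsilon:X\to\mathbb{R}^+$ is a strictly positive continuous function. A set $Y\subset\mathbb{R}^n$ is weakly $\mathscr{C}^r$ triangulable if there exist a locally finite simplicial complex $L$ of some $\mathbb{R}^q$ (each point of the realization $|L|$ has a neighborhood in $|L|$ meeting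 only finitely many simplices) and a homeomorphism $\Psi:|L|\to Y$ such that the restriction $\Psi|_\xi:\xi\to Y$ is a $\mathscr{C}^r$ map for each simplex $\xi\in L$. $\pi_p(Y,y_0)$ denotes the $p$-th homotopy group of the pointed space $(Y,y_0)$; its elements are understood as the (pointed) homotopy classes of continuous maps $(\mathbb{S}^p,N)\to(Y,y_0)$, where $\mathbb{S}^p\subset\mathbb{R}^{p+1}$ is the standard $p$-sphere and $N$ is its north pole. *)

theory Defs
  imports "HOL-Analysis.Analysis" "HOL-Library.Extended_Nat"
begin

text \<open>Iterated Frechet differentiability with continuous last derivative. It is only meant for
  open \<open>U\<close>: the derivatives are taken in the whole space. For fixed \<open>v\<close>, the function
  \<open>\<lambda>x. frechet_derivative f (at x) v\<close> is the directional derivative of \<open>f\<close> along \<open>v\<close>.\<close>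

primrec Ck_on :: "nat \<Rightarrow> 'a::euclidean_space set \<Rightarrow> ('a \<Rightarrow> 'b::euclidean_space) \<Rightarrow> bool" where
  "Ck_on 0 U f \<longleftrightarrow> continuous_on U f"
| "Ck_on (Suc k) U f \<longleftrightarrow>
     (\<forall>x\<in>U. f differentiable (at x)) \<and> (\<forall>v. Ck_on k U (\<lambda>x. frechet_derivative f (at x) v))"

definition Cr_on :: "enat \<Rightarrow> 'a::euclidean_space set \<Rightarrow> ('a \<Rightarrow> 'b::euclidean_space) \<Rightarrow> bool" where
  "Cr_on r U f \<longleftrightarrow> (\<forall>k::nat. enat k \<le> r \<longrightarrow> Ck_on k U f)"

text \<open>\<open>C\<^sup>r\<close> maps \<open>X \<rightarrow> Y\<close> between arbitrary subsets of Euclidean spaces. A map on \<open>X\<close> is represented by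
  a total function whose values outside \<open>X\<close> are irrelevant. Being closed in an open set, \<open>X\<close> is
  automatically locally compact.\<close>

definition Cr_map ::
    "enat \<Rightarrow> 'a::euclidean_space set \<Rightarrow> 'b::euclidean_space set \<Rightarrow> ('a \<Rightarrow> 'b) \<Rightarrow> bool" where
  "Cr_map r X Y g \<longleftrightarrow> g ` X \<subseteq> Y \<and>
     (\<exists>U G. open U \<and> closedin (top_of_set U) X \<and> Cr_on r U G \<and> (\<forall>x\<in>X. g x = G x))"

definition C0_maps :: "'a::topological_space set \<Rightarrow> 'b::topological_space set \<Rightarrow> ('a \<Rightarrow> 'b) set" where
  "C0_maps X Y = {g. continuous_on X g \<and> g ` X \<subseteq> Y}"

text \<open>Fundamental system of neighbourhoods of \<open>f\<close> in the strong (Whitney) \<open>C\<^sup>0\<close> topology.\<close>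

definition strong_C0_nhds ::
    "'a::euclidean_space set \<Rightarrow> 'b::euclidean_space set \<Rightarrow> ('a \<Rightarrow> 'b) \<Rightarrow> ('a \<Rightarrow> 'b) set set" where
  "strong_C0_nhds X Y f =
     {{g \<in> C0_maps X Y. \<forall>x\<in>X. norm (g x - f x) < \<epsilon> x} |
       \<epsilon> :: 'a \<Rightarrow> real. continuous_on X \<epsilon> \<and> (\<forall>x\<in>X. \<epsilon> x > 0)}"

text \<open>This is \<open>simplicial_complex\<close> with finiteness relaxed to local finiteness. As there, the
  empty set counts as the simplex of dimension \<open>-1\<close> and as a face of every simplex; this does not
  affect the realization \<open>\<Union>L\<close> or local finiteness.\<close>

definition locally_finite_simplicial_complex :: "'a::euclidean_space set set \<Rightarrow> bool" where
  "locally_finite_simplicial_complex L \<longleftrightarrow>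
     (\<forall>S\<in>L. \<exists>d. d simplex S) \<and>
     (\<forall>F S. S \<in> L \<and> F face_of S \<longrightarrow> F \<in> L) \<and>
     (\<forall>S S'. S \<in> L \<and> S' \<in> L \<longrightarrow> (S \<inter> S') face_of S) \<and>
     (\<forall>x\<in>\<Union>L. \<exists>N. x \<in> N \<and> openin (top_of_set (\<Union>L)) N \<and> finite {S \<in> L. S \<inter> N \<noteq> {}})"

text \<open>The type argument is the Euclidean space containing the complex. Since types cannot be
  quantified inside a formula, ``for some \<open>q\<close>, there is a complex in \<open>\<real>\<^sup>q\<close>'' in a hypothesis
  becomes a hypothesis on \<open>TYPE(real ^ 'q)\<close> with \<open>'q\<close> a type variable occurring nowhere else.\<close>

definition weakly_Cr_triangulable ::
    "'v::euclidean_space itself \<Rightarrow> enat \<Rightarrow> 'a::euclidean_space set \<Rightarrow> bool" where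
  "weakly_Cr_triangulable (_ :: 'v itself) r Y \<longleftrightarrow>
     (\<exists>(L :: 'v set set) \<Psi> \<Psi>'.
        locally_finite_simplicial_complex L \<and>
        homeomorphism (\<Union>L) Y \<Psi> \<Psi>' \<and>
        (\<forall>\<xi>\<in>L. Cr_map r \<xi> Y \<Psi>))"

text \<open>\<open>\<real>\<^bsup>p+1\<^esup>\<close> is \<open>\<real>\<^sup>p \<times> \<real>\<close> with \<open>p = CARD('p) \<ge> 1\<close>; the norm of the product type is the
  Euclidean one.\<close>

definition std_sphere :: "((real ^ 'p) \<times> real) set" where
  "std_sphere = sphere 0 1"

definition north_pole :: "(real ^ 'p) \<times> real" where
  "north_pole = (0, 1)"

definition pointed_sphere_maps ::
    "'a::euclidean_space set \<Rightarrow> 'a \<Rightarrow> ((real ^ 'p) \<times> real \<Rightarrow> 'a) set" where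
  "pointed_sphere_maps Y y0 = {f \<in> C0_maps std_sphere Y. f north_pole = y0}"

definition pointed_homotopy ::
    "'a::euclidean_space set \<Rightarrow> 'a \<Rightarrow>
     (((real ^ 'p) \<times> real \<Rightarrow> 'a) \<times> ((real ^ 'p) \<times> real \<Rightarrow> 'a)) set" where
  "pointed_homotopy Y y0 =
     {(f, g). f \<in> pointed_sphere_maps Y y0 \<and> g \<in> pointed_sphere_maps Y y0 \<and>
        homotopic_with_canon (\<lambda>h. h north_pole = y0) std_sphere Y f g}"

lemma equiv_pointed_homotopy: "equiv (pointed_sphere_maps Y y0) (pointed_homotopy Y y0)"
  unfolding equiv_def refl_on_def sym_def trans_def pointed_homotopy_def
  by (auto simp: pointed_sphere_maps_def C0_maps_def homotopic_with_sym
           intro: homotopic_with_trans)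

text \<open>The underlying set of \<open>\<pi>\<^sub>p(Y, y\<^sub>0)\<close>; the group structure plays no role here.\<close>

definition homotopy_group_carrier ::
    "'a::euclidean_space set \<Rightarrow> 'a \<Rightarrow> ((real ^ 'p) \<times> real \<Rightarrow> 'a) set set" where
  "homotopy_group_carrier Y y0 = pointed_sphere_maps Y y0 // pointed_homotopy Y y0"

end

theory Submission
  imports Defs
begin

text \<open>
  Let \<open>\<Psi> : |L| \<rightarrow> Y\<close> be the triangulation and \<open>f : X \<rightarrow> Y\<close> a continuous map on a compact set \<open>X\<close>.
  Smoothing \<open>g = \<Psi>\<^sup>-\<^sup>1 \<circ> f\<close> as a map into the ambient space of \<open>L\<close> may leave \<open>|L|\<close>, and \<open>\<Psi>\<close> is \<open>C\<^sup>r\<close>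
  only on single simplices. But \<open>\<Psi> \<circ> h\<close> is \<open>C\<^sup>r\<close> for a smooth \<open>h\<close> as soon as every point of \<open>X\<close> has an
  open neighbourhood in the whole Euclidean space that \<open>h\<close> sends into one simplex \<open>S\<close>, because there
  \<open>\<Psi> \<circ> h = G \<circ> h\<close> with \<open>G\<close> a \<open>C\<^sup>r\<close> extension of \<open>\<Psi>\<close> from \<open>S\<close>.

  Such an \<open>h\<close> is obtained by smoothing barycentric coordinates. Write
  \<open>g(x) = \<Sum>\<^sub>v b\<^sub>v(g(x)) v\<close>, a finite sum because \<open>g(X)\<close> is compact and \<open>L\<close> locally finite. Replace
  each continuous function \<open>b\<^sub>v \<circ> g \<ge> 0\<close> by a nearby smooth \<open>w\<^sub>v \<ge> 0\<close> that vanishes in a neighbourhood of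
  every zero of \<open>b\<^sub>v \<circ> g\<close> (\<open>smooth_approximation_vanishing_near_zeros\<close>), and normalize:
  \<open>h = (\<Sum>\<^sub>v w\<^sub>v v) / (\<Sum>\<^sub>v w\<^sub>v)\<close>. If \<open>g(x)\<close> lies in a simplex \<open>S\<close>, then \<open>b\<^sub>v(g(x)) = 0\<close> for each vertex \<open>v\<close>
  outside \<open>S\<close>, so near \<open>x\<close> the value of \<open>h\<close> is a convex combination of vertices of \<open>S\<close>; this is
  \<open>smooth_approximation_in_complex\<close>.

  The weights \<open>w\<^sub>v\<close> can be prescribed exactly on a finite set, so \<open>h\<close> agrees with \<open>g\<close> at the two end
  points of a path, or at the north pole. As \<open>g(x)\<close> and \<open>h(x)\<close> share a simplex, the straight-line homotopy
  from \<open>g\<close> to \<open>h\<close> stays in \<open>|L|\<close> and is constant on the finite set. Hence both assertions follow from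
  one theorem on compact sets, \<open>triangulable_smooth_approximation\<close>.
\<close>

section \<open>Calculus of iterated differentiability\<close>

lemma Ck_on_cong:
  fixes f g :: "'a::euclidean_space \<Rightarrow> 'b::euclidean_space"
  assumes "open U" "\<And>x. x \<in> U \<Longrightarrow> f x = g x" "Ck_on k U f"
  shows "Ck_on k U g"
  using assms
proof (induction k arbitrary: f g)
  case 0
  then show ?case by (simp cong: continuous_on_cong)
next
  case (Suc k)
  have der: "(g has_derivative frechet_derivative f (at x)) (at x)" if "x \<in> U" for x
  proof -
    have "(f has_derivative frechet_derivative f (at x)) (at x)"
      using Suc.prems that by (simp add: frechet_derivative_works)
    then show ?thesis
      by (rule has_derivative_transform_within_open[OF _ Suc.prems(1) that]) (use Suc.prems in auto)
  qed
  have "frechet_derivative f (at x) = frechet_derivative g (at x)" if "x \<in> U" for x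
    using frechet_derivative_at[OF der[OF that]] .
  then have "Ck_on k U (\<lambda>x. frechet_derivative g (at x) v)" for v
    using Suc.IH[of "\<lambda>x. frechet_derivative f (at x) v" "\<lambda>x. frechet_derivative g (at x) v"] Suc.prems
    by auto
  then show ?case using der by (auto simp: differentiable_def)
qed

text \<open>Since \<open>frechet_derivative\<close> is a choice of derivative, it is more convenient to exhibit any
  family of derivatives. Openness of \<open>U\<close> allows to pass from one to the other by \<open>Ck_on_cong\<close>.\<close>

lemma Ck_on_Suc_iff:
  fixes f :: "'a::euclidean_space \<Rightarrow> 'b::euclidean_space"
  assumes "open U"
  shows "Ck_on (Suc k) U f \<longleftrightarrow>
    (\<exists>f'. (\<forall>x\<in>U. (f has_derivative f' x) (at x)) \<and> (\<forall>v. Ck_on k U (\<lambda>x. f' x v)))"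
proof
  assume "Ck_on (Suc k) U f"
  then show "\<exists>f'. (\<forall>x\<in>U. (f has_derivative f' x) (at x)) \<and> (\<forall>v. Ck_on k U (\<lambda>x. f' x v))"
    by (intro exI[of _ "\<lambda>x. frechet_derivative f (at x)"]) (auto simp: frechet_derivative_works)
next
  assume "\<exists>f'. (\<forall>x\<in>U. (f has_derivative f' x) (at x)) \<and> (\<forall>v. Ck_on k U (\<lambda>x. f' x v))"
  then obtain f' where f': "\<And>x. x \<in> U \<Longrightarrow> (f has_derivative f' x) (at x)"
    and Ck: "\<And>v. Ck_on k U (\<lambda>x. f' x v)" by auto
  have "Ck_on k U (\<lambda>x. frechet_derivative f (at x) v)" for v
    by (rule Ck_on_cong[OF assms _ Ck[of v]]) (simp add: frechet_derivative_at[OF f', symmetric])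
  then show "Ck_on (Suc k) U f" using f' by (auto simp: differentiable_def)
qed

lemma Ck_on_SucI:
  fixes f :: "'a::euclidean_space \<Rightarrow> 'b::euclidean_space"
  assumes "open U" "\<And>x. x \<in> U \<Longrightarrow> (f has_derivative f' x) (at x)"
    "\<And>v. Ck_on k U (\<lambda>x. f' x v)"
  shows "Ck_on (Suc k) U f"
  using assms by (auto simp only: Ck_on_Suc_iff)

lemma Ck_on_SucE:
  fixes f :: "'a::euclidean_space \<Rightarrow> 'b::euclidean_space"
  assumes "open U" "Ck_on (Suc k) U f"
  obtains f' where "\<And>x. x \<in> U \<Longrightarrow> (f has_derivative f' x) (at x)"
    "\<And>v. Ck_on k U (\<lambda>x. f' x v)"
  using assms by (auto simp only: Ck_on_Suc_iff)

lemma Ck_on_Suc_imp: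
  fixes f :: "'a::euclidean_space \<Rightarrow> 'b::euclidean_space"
  shows "Ck_on (Suc k) U f \<Longrightarrow> Ck_on k U f"
proof (induction k arbitrary: f)
  case 0
  then show ?case
    by (auto simp: continuous_on_eq_continuous_at intro!: continuous_at_imp_continuous_on
        differentiable_imp_continuous_within)
next
  case (Suc k)
  then show ?case by (metis Ck_on.simps(2))
qed

lemma Ck_on_imp_continuous_on:
  fixes f :: "'a::euclidean_space \<Rightarrow> 'b::euclidean_space"
  shows "Ck_on k U f \<Longrightarrow> continuous_on U f"
  by (induction k) (auto dest: Ck_on_Suc_imp simp del: Ck_on.simps(2))

lemma Ck_on_subset:
  fixes f :: "'a::euclidean_space \<Rightarrow> 'b::euclidean_space"
  shows "Ck_on k U f \<Longrightarrow> V \<subseteq> U \<Longrightarrow> Ck_on k V f"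
  by (induction k arbitrary: f) (auto intro: continuous_on_subset)

lemma Ck_on_local:
  fixes f :: "'a::euclidean_space \<Rightarrow> 'b::euclidean_space"
  assumes "\<And>x. x \<in> U \<Longrightarrow> \<exists>W. open W \<and> x \<in> W \<and> Ck_on k W f"
  shows "Ck_on k U f"
  using assms
proof (induction k arbitrary: f)
  case 0
  then show ?case
    by (metis Ck_on.simps(1) continuous_at_imp_continuous_on continuous_on_eq_continuous_at)
next
  case (Suc k)
  have "f differentiable at x" if "x \<in> U" for x
    using Suc.prems[OF that] by auto
  moreover have "Ck_on k U (\<lambda>x. frechet_derivative f (at x) v)" for v
    by (rule Suc.IH) (use Suc.prems in fastforce)
  ultimately show ?case by simp
qed

lemma Ck_on_const: "Ck_on k U (\<lambda>x::'a::euclidean_space. c::'b::euclidean_space)"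
  by (induction k arbitrary: c) auto

lemma Ck_on_add:
  fixes f g :: "'a::euclidean_space \<Rightarrow> 'b::euclidean_space"
  assumes "open U"
  shows "Ck_on k U f \<Longrightarrow> Ck_on k U g \<Longrightarrow> Ck_on k U (\<lambda>x. f x + g x)"
proof (induction k arbitrary: f g)
  case 0
  then show ?case by (auto intro: continuous_on_add)
next
  case (Suc k)
  obtain f' where f': "\<And>x. x \<in> U \<Longrightarrow> (f has_derivative f' x) (at x)" "\<And>v. Ck_on k U (\<lambda>x. f' x v)"
    using Ck_on_SucE[OF assms Suc.prems(1)] by blast
  obtain g' where g': "\<And>x. x \<in> U \<Longrightarrow> (g has_derivative g' x) (at x)" "\<And>v. Ck_on k U (\<lambda>x. g' x v)"
    using Ck_on_SucE[OF assms Suc.prems(2)] by blast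
  show ?case
    by (rule Ck_on_SucI[OF assms, where f' = "\<lambda>x v. f' x v + g' x v"])
       (auto intro: has_derivative_add f' g' Suc.IH)
qed

lemma Ck_on_sum:
  fixes f :: "'i \<Rightarrow> 'a::euclidean_space \<Rightarrow> 'b::euclidean_space"
  assumes "open U" "\<And>i. i \<in> I \<Longrightarrow> Ck_on k U (f i)"
  shows "Ck_on k U (\<lambda>x. \<Sum>i\<in>I. f i x)"
  using assms(2)
  by (induction I rule: infinite_finite_induct) (auto intro: Ck_on_const Ck_on_add[OF assms(1)])

lemma Ck_on_linear:
  fixes L :: "'b::euclidean_space \<Rightarrow> 'c::euclidean_space" and f :: "'a::euclidean_space \<Rightarrow> 'b"
  assumes "open U" "bounded_linear L"
  shows "Ck_on k U f \<Longrightarrow> Ck_on k U (\<lambda>x. L (f x))"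
proof (induction k arbitrary: f)
  case 0
  then show ?case by (auto intro: bounded_linear.continuous_on assms)
next
  case (Suc k)
  obtain f' where f': "\<And>x. x \<in> U \<Longrightarrow> (f has_derivative f' x) (at x)" "\<And>v. Ck_on k U (\<lambda>x. f' x v)"
    using Ck_on_SucE[OF assms(1) Suc.prems(1)] by blast
  show ?case
    by (rule Ck_on_SucI[OF assms(1), where f' = "\<lambda>x v. L (f' x v)"])
       (auto intro: bounded_linear.has_derivative assms f' Suc.IH)
qed

lemma Ck_on_id:
  assumes "open U"
  shows "Ck_on k U (\<lambda>x::'a::euclidean_space. x)"
proof (cases k)
  case (Suc j)
  show ?thesis unfolding Suc
    by (rule Ck_on_SucI[OF assms, where f' = "\<lambda>x v. v"]) (auto intro: Ck_on_const has_derivative_ident)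
qed auto

lemma Ck_on_bilinear:
  fixes f :: "'a::euclidean_space \<Rightarrow> 'b::euclidean_space" and g :: "'a \<Rightarrow> 'c::euclidean_space"
    and prod :: "'b \<Rightarrow> 'c \<Rightarrow> 'd::euclidean_space"
  assumes "open U" "bounded_bilinear prod"
  shows "Ck_on k U f \<Longrightarrow> Ck_on k U g \<Longrightarrow> Ck_on k U (\<lambda>x. prod (f x) (g x))"
proof (induction k arbitrary: f g)
  case 0
  then show ?case by (auto intro: bounded_bilinear.continuous_on[OF assms(2)])
next
  case (Suc k)
  obtain f' where f': "\<And>x. x \<in> U \<Longrightarrow> (f has_derivative f' x) (at x)" "\<And>v. Ck_on k U (\<lambda>x. f' x v)"
    using Ck_on_SucE[OF assms(1) Suc.prems(1)] by blast
  obtain g' where g': "\<And>x. x \<in> U \<Longrightarrow> (g has_derivative g' x) (at x)" "\<And>v. Ck_on k U (\<lambda>x. g' x v)"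
    using Ck_on_SucE[OF assms(1) Suc.prems(2)] by blast
  show ?case
    by (rule Ck_on_SucI[OF assms(1), where f' = "\<lambda>x v. prod (f x) (g' x v) + prod (f' x v) (g x)"])
       (intro bounded_bilinear.FDERIV[OF assms(2)] Ck_on_add[OF assms(1)] Suc.IH f' g'
          Ck_on_Suc_imp[OF Suc.prems(1)] Ck_on_Suc_imp[OF Suc.prems(2)]; assumption)+
qed

lemmas Ck_on_mult = Ck_on_bilinear[OF _ bounded_bilinear_mult]
lemmas Ck_on_scaleR = Ck_on_bilinear[OF _ bounded_bilinear_scaleR]

text \<open>The chain rule composes linear maps, which is not a pointwise operation on functions that the
  induction hypothesis covers. Expanding \<open>f' x v\<close> in the standard basis turns the derivative into a
  finite sum of products of real functions with functions \<open>(\<lambda>y. g' y i) \<circ> f\<close>, each with one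
  derivative less.\<close>

lemma Ck_on_compose:
  fixes f :: "'a::euclidean_space \<Rightarrow> 'b::euclidean_space" and g :: "'b \<Rightarrow> 'c::euclidean_space"
  assumes "open U" "open V" "f ` U \<subseteq> V"
  shows "Ck_on k U f \<Longrightarrow> Ck_on k V g \<Longrightarrow> Ck_on k U (\<lambda>x. g (f x))"
proof (induction k arbitrary: g)
  case 0
  then show ?case using assms(3) by (auto intro: continuous_on_compose2)
next
  case (Suc k)
  obtain f' where f': "\<And>x. x \<in> U \<Longrightarrow> (f has_derivative f' x) (at x)" "\<And>v. Ck_on k U (\<lambda>x. f' x v)"
    using Ck_on_SucE[OF assms(1) Suc.prems(1)] by blast
  obtain g' where g': "\<And>x. x \<in> V \<Longrightarrow> (g has_derivative g' x) (at x)" "\<And>v. Ck_on k V (\<lambda>x. g' x v)"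
    using Ck_on_SucE[OF assms(2) Suc.prems(2)] by blast
  have fV: "f x \<in> V" if "x \<in> U" for x using assms(3) that by auto
  have "Ck_on k U (\<lambda>x. g' (f x) (f' x v))" for v
  proof (rule Ck_on_cong[OF assms(1)])
    show "(\<Sum>i\<in>Basis. (f' x v \<bullet> i) *\<^sub>R g' (f x) i) = g' (f x) (f' x v)" if "x \<in> U" for x
    proof -
      have "linear (g' (f x))"
        using g'(1)[OF fV[OF that]] has_derivative_linear by blast
      then show ?thesis
        by (subst (2) euclidean_representation[symmetric, of "f' x v"])
           (simp add: linear_sum linear_scale)
    qed
    show "Ck_on k U (\<lambda>x. \<Sum>i\<in>Basis. (f' x v \<bullet> i) *\<^sub>R g' (f x) i)"
      by (intro Ck_on_sum Ck_on_scaleR assms(1) Suc.IH g' Ck_on_Suc_imp[OF Suc.prems(1)]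
          Ck_on_linear[OF _ bounded_linear_inner_left] f')
  qed
  then show ?case
    by (intro Ck_on_SucI[OF assms(1), where f' = "\<lambda>x v. g' (f x) (f' x v)"]
        has_derivative_compose[OF f'(1) g'(1)] fV)
qed

lemma Ck_on_inverse:
  fixes f :: "'a::euclidean_space \<Rightarrow> real"
  assumes "open U" "\<And>x. x \<in> U \<Longrightarrow> f x \<noteq> 0"
  shows "Ck_on k U f \<Longrightarrow> Ck_on k U (\<lambda>x. inverse (f x))"
proof (induction k)
  case 0
  then show ?case using assms(2) by (auto intro: continuous_on_inverse)
next
  case (Suc k)
  obtain f' where f': "\<And>x. x \<in> U \<Longrightarrow> (f has_derivative f' x) (at x)" "\<And>v. Ck_on k U (\<lambda>x. f' x v)"
    using Ck_on_SucE[OF assms(1) Suc.prems(1)] by blast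
  have inv: "Ck_on k U (\<lambda>x. inverse (f x))" using Suc Ck_on_Suc_imp by blast
  show ?case
  proof (rule Ck_on_SucI[OF assms(1)])
    show "((\<lambda>x. inverse (f x)) has_derivative (\<lambda>v. - (inverse (f x) * f' x v * inverse (f x)))) (at x)"
      if "x \<in> U" for x
      using Deriv.has_derivative_inverse[OF assms(2)[OF that] f'(1)[OF that]] by simp
    show "Ck_on k U (\<lambda>x. - (inverse (f x) * f' x v * inverse (f x)))" for v
      by (intro Ck_on_linear[OF _ bounded_linear_minus[OF bounded_linear_ident]] Ck_on_mult assms(1) inv f')
  qed
qed

lemma Ck_on_real_polynomial_function:
  fixes p :: "'a::euclidean_space \<Rightarrow> real"
  assumes "open U"
  shows "real_polynomial_function p \<Longrightarrow> Ck_on k U p"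
proof (induction rule: real_polynomial_function.induct)
  case (linear f)
  then show ?case using Ck_on_linear[OF assms linear Ck_on_id[OF assms]] by simp
qed (auto intro: Ck_on_const Ck_on_add Ck_on_mult assms)

section \<open>A smooth cut-off of the identity\<close>

text \<open>For constant \<open>p = 1\<close> this is the classical smooth non-analytic function \<open>exp (-1/t)\<close>. Arbitrary
  polynomials \<open>p\<close> are allowed in order that the family be closed under differentiation.\<close>

definition flat :: "real poly \<Rightarrow> real \<Rightarrow> real" where
  "flat p t = (if t > 0 then poly p (inverse t) * exp (- inverse t) else 0)"

lemma flat_tendsto_0: "(flat p \<longlongrightarrow> 0) (at 0)"
proof (rule filterlim_split_at)
  have "((\<lambda>t. 0) \<longlongrightarrow> (0::real)) (at_left 0)" by simp
  then show "(flat p \<longlongrightarrow> 0) (at_left 0)"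
    by (rule Lim_transform_eventually) (auto simp: flat_def eventually_at_filter)
next
  have "((\<lambda>s. \<Sum>i\<le>degree p. coeff p i * (s ^ i / exp s)) \<longlongrightarrow> (\<Sum>i\<le>degree p. coeff p i * 0)) at_top"
    by (intro tendsto_sum tendsto_mult tendsto_const tendsto_power_div_exp_0)
  then have "((\<lambda>s. poly p s * exp (- s)) \<longlongrightarrow> 0) at_top"
    by (simp add: poly_altdef sum_divide_distrib exp_minus field_simps)
  then have "((\<lambda>t. poly p (inverse t) * exp (- inverse t)) \<longlongrightarrow> 0) (at_right 0)"
    by (rule filterlim_compose[OF _ filterlim_inverse_at_top_right])
  then show "(flat p \<longlongrightarrow> 0) (at_right 0)"
    by (rule Lim_transform_eventually) (auto simp: flat_def eventually_at_filter)
qed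

text \<open>At the origin the difference quotient of \<open>flat p\<close> is \<open>flat (pCons 0 p)\<close>, so that the preceding
  limit, for another polynomial, gives derivative \<open>0\<close>.\<close>

lemma flat_has_derivative:
  "(flat p has_real_derivative flat (monom 1 2 * (p - pderiv p)) t) (at t)"
proof -
  consider "t < 0" | "t = 0" | "t > 0" by linarith
  then show ?thesis
  proof cases
    case 1
    have "((\<lambda>t. 0) has_real_derivative 0) (at t)" by simp
    then have "(flat p has_real_derivative 0) (at t)"
      by (rule has_field_derivative_transform_within_open[where S = "{..<0}"])
         (use 1 in \<open>auto simp: flat_def\<close>)
    then show ?thesis using 1 by (simp add: flat_def)
  next
    case 2
    have "((\<lambda>h. (flat p (0 + h) - flat p 0) / h) \<longlongrightarrow> 0) (at 0)"
      by (rule Lim_transform_eventually[OF flat_tendsto_0[of "pCons 0 p"]])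
         (auto simp: flat_def eventually_at_filter field_simps)
    then show ?thesis using 2 by (simp add: DERIV_def flat_def)
  next
    case 3
    have "((\<lambda>t. poly p (inverse t) * exp (- inverse t)) has_real_derivative
        poly (monom 1 2 * (p - pderiv p)) (inverse t) * exp (- inverse t)) (at t)"
      using 3 by (auto intro!: derivative_eq_intros DERIV_chain'[OF _ poly_DERIV]
          simp: poly_monom power2_eq_square algebra_simps)
    then have "(flat p has_real_derivative
        poly (monom 1 2 * (p - pderiv p)) (inverse t) * exp (- inverse t)) (at t)"
      by (rule has_field_derivative_transform_within_open[where S = "{0<..}"])
         (use 3 in \<open>auto simp: flat_def\<close>)
    then show ?thesis using 3 by (simp add: flat_def)
  qed
qed

lemma Ck_on_flat: "Ck_on k UNIV (flat p)"
proof (induction k arbitrary: p)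
  case 0
  show ?case
    by (auto intro!: continuous_at_imp_continuous_on DERIV_isCont[OF flat_has_derivative])
next
  case (Suc k)
  show ?case
    by (rule Ck_on_SucI[where f' = "\<lambda>x v. flat (monom 1 2 * (p - pderiv p)) x * v"])
       (auto intro: Ck_on_mult Suc Ck_on_const flat_has_derivative[unfolded has_field_derivative_def])
qed

text \<open>A cut-off that is the identity beyond \<open>2\<delta>\<close>, rather than merely close to it, keeps exact
  values at points where the function to be cut off is at least \<open>2\<delta>\<close>.\<close>

lemma smooth_cutoff_identity:
  fixes \<delta> :: real
  assumes "\<delta> > 0"
  obtains \<phi> where "\<And>k. Ck_on k UNIV \<phi>" "\<And>t. t \<le> \<delta> \<Longrightarrow> \<phi> t = 0" "\<And>t. t \<ge> 2 * \<delta> \<Longrightarrow> \<phi> t = t"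
    "\<And>t. t \<ge> 0 \<Longrightarrow> 0 \<le> \<phi> t \<and> \<phi> t \<le> t"
proof
  define a b where "a = (\<lambda>t. flat 1 (t - \<delta>))" and "b = (\<lambda>t. flat 1 (2 * \<delta> - t))"
  define \<phi> where "\<phi> = (\<lambda>t. t * (a t * inverse (a t + b t)))"
  have nonneg: "a t \<ge> 0" "b t \<ge> 0" for t by (auto simp: a_def b_def flat_def)
  have pos: "a t + b t > 0" for t
    using assms by (auto simp: a_def b_def flat_def intro: add_pos_nonneg add_nonneg_pos add_pos_pos)
  have affine: "Ck_on k UNIV (\<lambda>t::real. c + d * t)" for k and c d :: real
    by (intro Ck_on_add Ck_on_const Ck_on_mult Ck_on_id open_UNIV)
  have "Ck_on k UNIV a" for k
    using Ck_on_compose[OF _ _ _ affine[of k "-\<delta>" 1] Ck_on_flat[of k 1]] by (simp add: a_def)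
  moreover have "Ck_on k UNIV b" for k
    using Ck_on_compose[OF _ _ _ affine[of k "2 * \<delta>" "-1"] Ck_on_flat[of k 1]] by (simp add: b_def)
  ultimately show "Ck_on k UNIV \<phi>" for k
    unfolding \<phi>_def using pos
    by (intro Ck_on_mult Ck_on_inverse Ck_on_add Ck_on_id open_UNIV) (auto simp: less_imp_neq[THEN not_sym])
  show "\<phi> t = 0" if "t \<le> \<delta>" for t using that by (simp add: \<phi>_def a_def flat_def)
  show "\<phi> t = t" if "t \<ge> 2 * \<delta>" for t
  proof -
    have "b t = 0" using that by (simp add: b_def flat_def)
    then show ?thesis using pos[of t] by (simp add: \<phi>_def)
  qed
  show "0 \<le> \<phi> t \<and> \<phi> t \<le> t" if "t \<ge> 0" for t
  proof -
    have "a t * inverse (a t + b t) \<le> 1"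
      using nonneg[of t] pos[of t] by (simp add: field_simps)
    then show ?thesis
      using that nonneg[of t] pos[of t] mult_left_le[of "a t * inverse (a t + b t)" t]
      by (auto simp: \<phi>_def)
  qed
qed

section \<open>Smooth approximation of nonnegative functions\<close>

text \<open>The Weierstrass approximation is corrected at one point after the other, by a multiple of a
  Lagrange-type polynomial \<open>q\<close> that vanishes at the earlier points. On the compact set \<open>X\<close> the
  polynomial \<open>q\<close> is bounded by some \<open>B\<close>, so starting from an error below \<open>e / (1 + B)\<close> is enough.\<close>

lemma polynomial_approximation_interpolating:
  fixes u :: "'a::euclidean_space \<Rightarrow> real"
  assumes "compact X" "continuous_on X u" "finite F"
  shows "e > 0 \<Longrightarrow> \<exists>p. real_polynomial_function p \<and> (\<forall>x\<in>X. \<bar>p x - u x\<bar> < e) \<and> (\<forall>a\<in>F\<inter>X. p a = u a)"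
  using assms(3)
proof (induction F arbitrary: e)
  case empty
  then show ?case
    using Stone_Weierstrass_real_polynomial_function[OF assms(1,2)]
    by (metis Int_empty_left abs_minus_commute empty_iff)
next
  case (insert a F)
  show ?case
  proof (cases "a \<in> X")
    case False
    then show ?thesis using insert.IH[OF insert.prems] by simp
  next
    case True
    \<comment> \<open>a product of squared distances, written in coordinates so as to be visibly polynomial\<close>
    define q where "q = (\<lambda>x. \<Prod>b\<in>F. (\<Sum>i\<in>Basis. ((x - b) \<bullet> i)\<^sup>2) / (\<Sum>i\<in>Basis. ((a - b) \<bullet> i)\<^sup>2))"
    have q: "real_polynomial_function q"
      unfolding q_def
      by (intro real_polynomial_function_prod real_polynomial_function_divide real_polynomial_function_sum
          real_polynomial_function_power insert.hyps finite_Basis)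
         (simp add: inner_diff_left real_polynomial_function_diff real_polynomial_function.intros
           bounded_linear_inner_left)
    have qF: "q b = 0" if "b \<in> F" for b
      using that insert.hyps by (auto simp: q_def intro!: bexI[of _ b])
    have qa: "q a = 1"
    proof -
      have "(\<Sum>i\<in>Basis. ((a - b) \<bullet> i)\<^sup>2) \<noteq> 0" if "b \<in> F" for b
      proof -
        have "a \<noteq> b" using that insert.hyps by auto
        moreover have "(\<Sum>i\<in>Basis. ((a - b) \<bullet> i)\<^sup>2) = (norm (a - b))\<^sup>2"
          unfolding power2_norm_eq_inner by (subst (2) euclidean_inner) (simp add: power2_eq_square)
        ultimately show ?thesis by simp
      qed
      then show ?thesis by (simp add: q_def)
    qed
    have "compact (q ` X)"
      by (intro compact_continuous_image assms Ck_on_imp_continuous_on[of 0]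
          Ck_on_subset[OF Ck_on_real_polynomial_function[OF open_UNIV q]]) auto
    then obtain B where B: "B > 0" "\<And>x. x \<in> X \<Longrightarrow> \<bar>q x\<bar> \<le> B"
      by (auto dest!: compact_imp_bounded simp: bounded_pos)
    have "e / (1 + B) > 0" using B insert.prems by simp
    from insert.IH[OF this] obtain p where p: "real_polynomial_function p"
      "\<And>x. x \<in> X \<Longrightarrow> \<bar>p x - u x\<bar> < e / (1 + B)" "\<And>b. b \<in> F \<inter> X \<Longrightarrow> p b = u b" by blast
    show ?thesis
    proof (intro exI conjI ballI)
      show "real_polynomial_function (\<lambda>x. p x + (u a - p a) * q x)"
        by (intro real_polynomial_function.intros p q)
      show "p b + (u a - p a) * q b = u b" if "b \<in> insert a F \<inter> X" for b
        using that p(3) qF qa by auto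
      show "\<bar>p x + (u a - p a) * q x - u x\<bar> < e" if "x \<in> X" for x
      proof -
        have "\<bar>(u a - p a) * q x\<bar> \<le> e / (1 + B) * B"
          unfolding abs_mult using p(2)[OF True] B(2)[OF that]
          by (intro mult_mono) (auto simp: abs_minus_commute intro: order_trans[OF abs_ge_zero])
        then have "\<bar>p x + (u a - p a) * q x - u x\<bar> < e / (1 + B) + e / (1 + B) * B"
          using p(2)[OF that] by linarith
        also have "\<dots> = e / (1 + B) * (1 + B)" by (simp add: distrib_left)
        also have "\<dots> = e" using B(1) by simp
        finally show ?thesis .
      qed
    qed
  qed
qed

text \<open>Compose a polynomial approximation \<open>p\<close> of error less than \<open>\<delta>\<close> with the cut-off at \<open>\<delta>\<close>. Where \<open>u\<close>
  vanishes, \<open>p < \<delta>\<close>, an open condition in the whole space under which the composition is \<open>0\<close>. The values on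
  \<open>F\<close> survive because \<open>2\<delta>\<close> is below every positive value of \<open>u\<close> on \<open>F\<close>.\<close>

lemma smooth_approximation_vanishing_near_zeros:
  fixes u :: "'a::euclidean_space \<Rightarrow> real"
  assumes "compact X" "continuous_on X u" "\<And>x. x \<in> X \<Longrightarrow> u x \<ge> 0" "finite F" "F \<subseteq> X" "e > 0"
  shows "\<exists>w. (\<forall>k. Ck_on k UNIV w) \<and> (\<forall>x. w x \<ge> 0) \<and> (\<forall>x\<in>X. \<bar>w x - u x\<bar> < e) \<and> (\<forall>a\<in>F. w a = u a) \<and>
    (\<forall>x\<in>X. u x = 0 \<longrightarrow> (\<exists>W. open W \<and> x \<in> W \<and> (\<forall>y\<in>W. w y = 0)))"
proof -
  define \<delta> where "\<delta> = Min (insert (e / 3) ((\<lambda>a. u a / 2) ` {a \<in> F. u a > 0}))"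
  have fin: "finite ((\<lambda>a. u a / 2) ` {a \<in> F. u a > 0})" using assms by simp
  have \<delta>: "\<delta> > 0" "\<delta> \<le> e / 3"
    unfolding \<delta>_def using fin assms by (simp add: Min_gr_iff, intro Min_le, auto)
  have \<delta>F: "2 * \<delta> \<le> u a" if "a \<in> F" "u a > 0" for a
  proof -
    have "\<delta> \<le> u a / 2" unfolding \<delta>_def using fin that by (intro Min_le) auto
    then show ?thesis by simp
  qed
  obtain \<phi> where \<phi>: "\<And>k. Ck_on k UNIV \<phi>" "\<And>t. t \<le> \<delta> \<Longrightarrow> \<phi> t = 0" "\<And>t. t \<ge> 2 * \<delta> \<Longrightarrow> \<phi> t = t"
    "\<And>t. t \<ge> 0 \<Longrightarrow> 0 \<le> \<phi> t \<and> \<phi> t \<le> t"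
    using smooth_cutoff_identity[OF \<delta>(1)] by blast
  obtain p where p: "real_polynomial_function p" "\<And>x. x \<in> X \<Longrightarrow> \<bar>p x - u x\<bar> < \<delta>" "\<And>a. a \<in> F \<Longrightarrow> p a = u a"
    using polynomial_approximation_interpolating[OF assms(1,2,4) \<delta>(1)] assms(5) by blast
  have Ckp: "Ck_on k UNIV p" for k by (rule Ck_on_real_polynomial_function[OF open_UNIV p(1)])
  have \<phi>_close: "\<bar>\<phi> t - t\<bar> \<le> 2 * \<delta>" if "t > - \<delta>" for t
    using \<phi>(2,3,4)[of t] that \<delta>(1) by (cases "t \<ge> 2 * \<delta>"; cases "t \<ge> 0") auto
  show ?thesis
  proof (intro exI[of _ "\<lambda>x. \<phi> (p x)"] conjI allI ballI impI)
    show "Ck_on k UNIV (\<lambda>x. \<phi> (p x))" for k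
      by (rule Ck_on_compose[OF _ _ _ Ckp \<phi>(1)]) auto
    show "\<phi> (p x) \<ge> 0" for x
      using \<phi>(2)[of "p x"] \<phi>(4)[of "p x"] \<delta>(1) by (cases "p x \<ge> 0") auto
    show "\<bar>\<phi> (p x) - u x\<bar> < e" if "x \<in> X" for x
      using \<phi>_close[of "p x"] p(2)[OF that] assms(3)[OF that] \<delta> by linarith
    show "\<phi> (p a) = u a" if "a \<in> F" for a
      using p(3)[OF that] \<phi>(2)[of 0] \<phi>(3)[of "u a"] \<delta>(1) \<delta>F[OF that] assms(3)[of a] assms(5) that
      by (cases "u a > 0") force+
    show "\<exists>W. open W \<and> x \<in> W \<and> (\<forall>y\<in>W. \<phi> (p y) = 0)" if "x \<in> X" "u x = 0" for x
    proof (intro exI conjI ballI)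
      show "open (p -` {..<\<delta>})"
        by (rule open_vimage) (use Ck_on_imp_continuous_on[OF Ckp] in auto)
      show "x \<in> p -` {..<\<delta>}" using p(2)[OF that(1)] that(2) by auto
      show "\<phi> (p y) = 0" if "y \<in> p -` {..<\<delta>}" for y using that \<phi>(2) by auto
    qed
  qed
qed

section \<open>Barycentric coordinates\<close>

text \<open>Affine independence makes the vectors \<open>w - v\<close> with \<open>w \<noteq> v\<close> in \<open>C\<close> linearly independent, so some
  linear \<open>g\<close> takes the value \<open>-1\<close> on all of them. The affine function \<open>1 + g (x - v)\<close> is then \<open>1\<close> at
  \<open>v\<close> and \<open>0\<close> at the other points of \<open>C\<close>. Working with functions on the whole space gives continuity for
  free.\<close>

lemma barycentric_coordinate_exists:
  fixes C :: "'a::euclidean_space set"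
  assumes indep: "\<not> affine_dependent C" and "v \<in> C"
  shows "\<exists>l. continuous_on UNIV l \<and> (\<forall>u. sum u C = 1 \<longrightarrow> l (\<Sum>w\<in>C. u w *\<^sub>R w) = u v)"
proof -
  have fin: "finite C" using indep by (rule aff_independent_finite)
  have "C = insert v (C - {v})" using assms by auto
  then have "independent ((\<lambda>w. w - v) ` (C - {v}))"
    using indep affine_dependent_iff_dependent[of v "C - {v}"] by (auto simp: image_def)
  then obtain g :: "'a \<Rightarrow> real" where g: "linear g"
    "\<And>w. w \<in> C - {v} \<Longrightarrow> g (w - v) = -1"
    using linear_independent_extend[of "(\<lambda>w. w - v) ` (C - {v})" "\<lambda>_. -1::real"] by auto
  show ?thesis
  proof (intro exI[of _ "\<lambda>x. 1 + g (x - v)"] conjI allI impI)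
    show "continuous_on UNIV (\<lambda>x. 1 + g (x - v))"
      by (intro continuous_intros linear_continuous_on_compose[OF _ g(1)])
    fix u :: "'a \<Rightarrow> real" assume u: "sum u C = 1"
    have "(\<Sum>w\<in>C. u w *\<^sub>R w) - v = (\<Sum>w\<in>C. u w *\<^sub>R (w - v))"
      by (simp add: scaleR_diff_right sum_subtractf u scaleR_sum_left[symmetric])
    also have "g \<dots> = (\<Sum>w\<in>C. u w * g (w - v))"
      by (simp add: linear_sum[OF g(1)] linear_scale[OF g(1)])
    also have "\<dots> = (\<Sum>w\<in>C - {v}. u w * g (w - v))"
      using fin assms(2) by (subst sum.remove[of C v]) (auto simp: linear_0[OF g(1)])
    also have "\<dots> = - sum u (C - {v})"
      by (simp add: g(2) sum_negf)
    also have "\<dots> = u v - 1"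
      using fin assms(2) u by (simp add: sum_diff1)
    finally show "1 + g ((\<Sum>w\<in>C. u w *\<^sub>R w) - v) = u v" by simp
  qed
qed

text \<open>Outside \<open>C\<close> the coordinate is \<open>0\<close>: a point of a simplex has coordinate \<open>0\<close> at every vertex
  which the simplex does not have, so that coordinates of different simplices can be compared.\<close>

definition barycentric :: "'a::euclidean_space set \<Rightarrow> 'a \<Rightarrow> 'a \<Rightarrow> real" where
  "barycentric C v = (if v \<in> C
     then SOME l. continuous_on UNIV l \<and> (\<forall>u. sum u C = 1 \<longrightarrow> l (\<Sum>w\<in>C. u w *\<^sub>R w) = u v)
     else (\<lambda>x. 0))"

lemma
  assumes "\<not> affine_dependent C"
  shows continuous_on_barycentric: "continuous_on A (barycentric C v)"
    and barycentric_combination: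
      "sum u C = 1 \<Longrightarrow> barycentric C v (\<Sum>w\<in>C. u w *\<^sub>R w) = (if v \<in> C then u v else 0)"
proof -
  show "continuous_on A (barycentric C v)"
  proof (cases "v \<in> C")
    case True
    then show ?thesis
      using someI_ex[OF barycentric_coordinate_exists[OF assms True]]
      by (auto simp: barycentric_def intro: continuous_on_subset)
  qed (simp add: barycentric_def)
  show "barycentric C v (\<Sum>w\<in>C. u w *\<^sub>R w) = (if v \<in> C then u v else 0)" if "sum u C = 1"
    using someI_ex[OF barycentric_coordinate_exists[OF assms, of v]] that
    by (auto simp: barycentric_def)
qed

lemma barycentric_convex_hull:
  assumes "\<not> affine_dependent C" "x \<in> convex hull C"
  shows "barycentric C v x \<ge> 0" "(\<Sum>v\<in>C. barycentric C v x) = 1"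
    "(\<Sum>v\<in>C. barycentric C v x *\<^sub>R v) = x"
proof -
  obtain u where u: "\<And>w. w \<in> C \<Longrightarrow> u w \<ge> 0" "sum u C = 1" "x = (\<Sum>w\<in>C. u w *\<^sub>R w)"
    using assms aff_independent_finite[OF assms(1)] by (auto simp: convex_hull_finite)
  have "barycentric C v x = (if v \<in> C then u v else 0)" for v
    using barycentric_combination[OF assms(1) u(2)] u(3) by simp
  then show "barycentric C v x \<ge> 0" "(\<Sum>v\<in>C. barycentric C v x) = 1"
    "(\<Sum>v\<in>C. barycentric C v x *\<^sub>R v) = x"
    using u by (auto simp del: u(3) cong: sum.cong)
qed

lemma barycentric_face:
  assumes "\<not> affine_dependent C" "D \<subseteq> C" "x \<in> convex hull D"
  shows "barycentric C v x = barycentric D v x"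
proof -
  have indepD: "\<not> affine_dependent D" using assms affine_dependent_subset by blast
  have fin: "finite C" using assms(1) by (rule aff_independent_finite)
  then have "finite D" using assms(2) finite_subset by blast
  then obtain u where u: "\<And>w. w \<in> D \<Longrightarrow> u w \<ge> 0" "sum u D = 1" "x = (\<Sum>w\<in>D. u w *\<^sub>R w)"
    using assms(3) by (auto simp: convex_hull_finite)
  define u' where "u' = (\<lambda>w. if w \<in> D then u w else 0)"
  have 1: "sum u' C = 1"
    using sum.mono_neutral_right[OF fin assms(2), of u'] u(2) by (simp add: u'_def)
  have 2: "(\<Sum>w\<in>C. u' w *\<^sub>R w) = x"
    using sum.mono_neutral_right[OF fin assms(2), of "\<lambda>w. u' w *\<^sub>R w"] u(3) by (simp add: u'_def)
  show ?thesis
    using barycentric_combination[OF assms(1) 1, of v] barycentric_combination[OF indepD u(2), of v]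
      2 u(3) assms(2) by (auto simp: u'_def)
qed

definition vertices :: "'a::euclidean_space set \<Rightarrow> 'a set" where
  "vertices S = {v. v extreme_point_of S}"

lemma vertices_convex_hull: "\<not> affine_dependent C \<Longrightarrow> vertices (convex hull C) = C"
  by (simp add: vertices_def extreme_point_of_convex_hull_affine_independent)

lemma simplex_vertices:
  assumes "d simplex S"
  shows "\<not> affine_dependent (vertices S)" "convex hull (vertices S) = S" "finite (vertices S)"
  using assms by (auto simp: simplex_def vertices_convex_hull aff_independent_finite)

lemma simplex_vertices_face:
  assumes "d simplex S" "T face_of S"
  shows "vertices T \<subseteq> vertices S" "convex hull (vertices T) = T"
proof -
  note S = simplex_vertices[OF assms(1)]
  obtain c where c: "c \<subseteq> vertices S" "T = convex hull c"
    using face_of_convex_hull_affine_independent[OF S(1), of T] assms(2) S(2) by auto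
  moreover have "vertices T = c"
    using c S(1) affine_dependent_subset vertices_convex_hull by blast
  ultimately show "vertices T \<subseteq> vertices S" "convex hull (vertices T) = T" by auto
qed

section \<open>Coordinates on a locally finite simplicial complex\<close>

definition simplicial_coordinate :: "'a::euclidean_space set set \<Rightarrow> 'a \<Rightarrow> 'a \<Rightarrow> real" where
  "simplicial_coordinate L v x = barycentric (vertices (SOME S. S \<in> L \<and> x \<in> S)) v x"

context
  fixes L :: "'a::euclidean_space set set"
  assumes L: "locally_finite_simplicial_complex L"
begin

lemma complex_vertices:
  assumes "S \<in> L"
  shows "\<not> affine_dependent (vertices S)" "convex hull (vertices S) = S" "finite (vertices S)"
proof -
  obtain d where "d simplex S"
    using L assms unfolding locally_finite_simplicial_complex_def by blast
  then show "\<not> affine_dependent (vertices S)" "convex hull (vertices S) = S" "finite (vertices S)"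
    by (rule simplex_vertices)+
qed

text \<open>Two simplices containing \<open>x\<close> intersect in a common face, and by \<open>barycentric_face\<close> the
  coordinates of \<open>x\<close> in either of them are those in that face; so the chosen simplex is immaterial.\<close>

lemma simplicial_coordinate_eq:
  assumes "S \<in> L" "x \<in> S"
  shows "simplicial_coordinate L v x = barycentric (vertices S) v x"
proof -
  have eq: "barycentric (vertices A) v x = barycentric (vertices (A \<inter> B)) v x"
    if AB: "A \<in> L" "B \<in> L" "x \<in> A" "x \<in> B" for A B
  proof -
    have face: "A \<inter> B face_of A"
      using L AB unfolding locally_finite_simplicial_complex_def by blast
    obtain d where d: "d simplex A"
      using L AB unfolding locally_finite_simplicial_complex_def by blast
    show ?thesis
      by (rule barycentric_face)
         (use simplex_vertices_face[OF d face] simplex_vertices(1)[OF d] AB in auto)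
  qed
  define T where "T = (SOME S. S \<in> L \<and> x \<in> S)"
  have T: "T \<in> L" "x \<in> T"
    using someI[of "\<lambda>S. S \<in> L \<and> x \<in> S", OF conjI[OF assms]] by (auto simp: T_def)
  show ?thesis
    using eq[OF assms(1) T(1) assms(2) T(2)] eq[OF T(1) assms(1) T(2) assms(2)]
    by (simp add: simplicial_coordinate_def T_def[symmetric] Int_commute)
qed

lemma finite_simplices_meeting_compact:
  assumes "compact C" "C \<subseteq> \<Union>L"
  shows "finite {S \<in> L. S \<inter> C \<noteq> {}}"
proof -
  have "\<exists>T. open T \<and> x \<in> T \<and> finite {S \<in> L. S \<inter> (\<Union>L \<inter> T) \<noteq> {}}" if "x \<in> C" for x
  proof -
    have "\<forall>x\<in>\<Union>L. \<exists>N. x \<in> N \<and> openin (top_of_set (\<Union>L)) N \<and> finite {S \<in> L. S \<inter> N \<noteq> {}}"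
      using L unfolding locally_finite_simplicial_complex_def by (elim conjE)
    from bspec[OF this subsetD[OF assms(2) that]] obtain N
      where N: "x \<in> N" "openin (top_of_set (\<Union>L)) N" "finite {S \<in> L. S \<inter> N \<noteq> {}}"
      by (elim exE conjE)
    from N(2) obtain T where "open T" "N = \<Union>L \<inter> T" unfolding openin_open by (elim exE conjE)
    then show ?thesis using N(1,3) by (intro exI[of _ T]) simp
  qed
  then have "\<forall>x\<in>C. \<exists>T. open T \<and> x \<in> T \<and> finite {S \<in> L. S \<inter> (\<Union>L \<inter> T) \<noteq> {}}" by (rule ballI)
  from bchoice[OF this] obtain T
    where T: "\<forall>x\<in>C. open (T x) \<and> x \<in> T x \<and> finite {S \<in> L. S \<inter> (\<Union>L \<inter> T x) \<noteq> {}}"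
    by (elim exE)
  obtain D where D: "D \<subseteq> C" "finite D" "C \<subseteq> (\<Union>x\<in>D. T x)"
    by (rule compactE_image[OF assms(1), of C T]) (use T in auto)
  have "{S \<in> L. S \<inter> C \<noteq> {}} \<subseteq> (\<Union>x\<in>D. {S \<in> L. S \<inter> (\<Union>L \<inter> T x) \<noteq> {}})"
  proof
    fix S assume "S \<in> {S \<in> L. S \<inter> C \<noteq> {}}"
    then obtain y where y: "S \<in> L" "y \<in> S" "y \<in> C" by auto
    then obtain x where "x \<in> D" "y \<in> T x" using D(3) by auto
    then show "S \<in> (\<Union>x\<in>D. {S \<in> L. S \<inter> (\<Union>L \<inter> T x) \<noteq> {}})"
      using y by (intro UN_I[of x]) auto
  qed
  moreover have "finite (\<Union>x\<in>D. {S \<in> L. S \<inter> (\<Union>L \<inter> T x) \<noteq> {}})"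
    using D(1,2) T by (intro finite_UN_I) auto
  ultimately show ?thesis by (rule finite_subset)
qed

lemma compact_simplex_in_complex:
  assumes "S \<in> L"
  shows "compact S" "convex S"
proof -
  have "compact (convex hull (vertices S))" "convex (convex hull (vertices S))"
    by (rule finite_imp_compact_convex_hull[OF complex_vertices(3)[OF assms]], rule convex_convex_hull)
  then show "compact S" "convex S" by (simp_all only: complex_vertices(2)[OF assms])
qed

text \<open>Pasting over finitely many closed simplices; by \<open>finite_simplices_meeting_compact\<close> this covers
  every compact subset of the realization.\<close>

lemma continuous_on_simplicial_coordinate:
  assumes "finite K" "K \<subseteq> L"
  shows "continuous_on (\<Union>K) (simplicial_coordinate L v)"
proof -
  have "continuous_on (\<Union>S\<in>K. S) (simplicial_coordinate L v)"
  proof (rule continuous_on_closed_Union[OF assms(1)])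
    fix S assume S: "S \<in> K"
    with assms(2) have SL: "S \<in> L" by (rule subsetD)
    show "closed S" by (rule compact_imp_closed[OF compact_simplex_in_complex(1)[OF SL]])
    show "continuous_on S (simplicial_coordinate L v)"
      using continuous_on_barycentric[OF complex_vertices(1)[OF SL], of S v]
      by (rule continuous_on_eq) (simp add: simplicial_coordinate_eq[OF SL])
  qed
  then show ?thesis by simp
qed

section \<open>Smoothing maps into a triangulated set\<close>

text \<open>The neighbourhood \<open>W\<close> is open in the whole source space and not just in \<open>X\<close>, so that the
  composition with the triangulation will be \<open>C\<^sup>r\<close> on an open neighbourhood of \<open>X\<close>. One \<open>W\<close> serves all simplices through \<open>g x\<close> at once:
  it is chosen so that \<open>w v\<close> vanishes on it for every \<open>v\<close> with coordinate \<open>0\<close> at \<open>g x\<close>.\<close>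

lemma smooth_approximation_in_complex:
  fixes g :: "'b::euclidean_space \<Rightarrow> 'a"
  assumes X: "compact X" and g: "continuous_on X g" "g ` X \<subseteq> \<Union>L"
    and F: "finite F" "F \<subseteq> X" and "\<rho> > 0"
  shows "\<exists>h. (\<forall>x\<in>X. dist (h x) (g x) < \<rho>) \<and> (\<forall>a\<in>F. h a = g a) \<and>
    (\<forall>x\<in>X. \<exists>W. open W \<and> x \<in> W \<and> (\<forall>k. Ck_on k W h) \<and> (\<forall>S\<in>L. g x \<in> S \<longrightarrow> (\<forall>y\<in>W. h y \<in> S)))"
proof -
  define K where "K = {S \<in> L. S \<inter> g ` X \<noteq> {}}"
  have cgX: "compact (g ` X)" using compact_continuous_image[OF g(1) X] .
  have finK: "finite K" unfolding K_def by (rule finite_simplices_meeting_compact[OF cgX g(2)])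
  define V where "V = (\<Union>S\<in>K. vertices S)"
  have finV: "finite V"
    unfolding V_def by (rule finite_UN_I[OF finK], rule complex_vertices(3)) (simp add: K_def)
  define c where "c = (\<lambda>v x. simplicial_coordinate L v (g x))"
  have in_L: "\<exists>S. S \<in> L \<and> g x \<in> S" if "x \<in> X" for x
    using g(2) that by auto
  have in_K: "S \<in> K" if "x \<in> X" "S \<in> L" "g x \<in> S" for x S using that by (auto simp: K_def)
  have c_outside: "c v x = 0" if "S \<in> L" "g x \<in> S" "v \<notin> vertices S" for v x S
    using that(3) by (simp add: c_def simplicial_coordinate_eq[OF that(1,2)] barycentric_def)
  have c_nonneg: "c v x \<ge> 0" if "x \<in> X" for v x
  proof -
    from in_L[OF that] obtain S where S: "S \<in> L" "g x \<in> S" by (elim exE conjE)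
    then have "g x \<in> convex hull (vertices S)" by (simp only: complex_vertices(2))
    then show ?thesis
      unfolding c_def simplicial_coordinate_eq[OF S]
      by (rule barycentric_convex_hull(1)[OF complex_vertices(1)[OF S(1)]])
  qed
  have c_sum: "(\<Sum>v\<in>V. c v x) = 1" "(\<Sum>v\<in>V. c v x *\<^sub>R v) = g x" if x: "x \<in> X" for x
  proof -
    obtain S where S: "S \<in> L" "g x \<in> S" using in_L[OF x] by (elim exE conjE)
    have SV: "vertices S \<subseteq> V" using in_K[OF x S] by (auto simp: V_def)
    have "(\<Sum>v\<in>V. c v x) = (\<Sum>v\<in>vertices S. c v x)"
         "(\<Sum>v\<in>V. c v x *\<^sub>R v) = (\<Sum>v\<in>vertices S. c v x *\<^sub>R v)"
      by (intro sum.mono_neutral_right finV SV; simp add: c_outside[OF S])+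
    then show "(\<Sum>v\<in>V. c v x) = 1" "(\<Sum>v\<in>V. c v x *\<^sub>R v) = g x"
      using barycentric_convex_hull(2,3)[of "vertices S" "g x"] complex_vertices[OF S(1)] S(2)
      by (simp_all add: c_def simplicial_coordinate_eq[OF S])
  qed
  have c_cont: "continuous_on X (c v)" for v
    unfolding c_def
  proof (rule continuous_on_compose2[OF continuous_on_simplicial_coordinate[OF finK] g(1)])
    show "K \<subseteq> L" by (auto simp: K_def)
    show "g ` X \<subseteq> \<Union>K"
    proof (rule image_subsetI)
      fix x assume x: "x \<in> X"
      obtain S where "S \<in> L" "g x \<in> S" using in_L[OF x] by (elim exE conjE)
      then show "g x \<in> \<Union>K" using in_K[OF x] by (intro UnionI)
    qed
  qed

  obtain B1 where B1: "B1 > 0" "\<And>v. v \<in> V \<Longrightarrow> norm v \<le> B1"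
    using finite_imp_bounded[OF finV] by (auto simp: bounded_pos)
  obtain B2 where B2: "B2 > 0" "\<And>x. x \<in> X \<Longrightarrow> norm (g x) \<le> B2"
    using compact_imp_bounded[OF cgX] by (auto simp: bounded_pos)
  define B where "B = B1 + B2"
  have B: "B > 0" "\<And>v x. v \<in> V \<Longrightarrow> x \<in> X \<Longrightarrow> norm (v - g x) \<le> B"
    unfolding B_def using B1(1) B2(1)
    by (simp, intro order_trans[OF norm_triangle_ineq4] add_mono B1(2) B2(2))
  \<comment> \<open>The weights are off by less than \<open>m \<le> 1/2\<close> in total, so their sum \<open>s\<close> exceeds \<open>1/2\<close> on \<open>X\<close>
    and the normalized point is off by less than \<open>2 * m * B\<close>.\<close>
  define m where "m = min (1/2) (\<rho> / (2 * B))"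
  define e where "e = m / (real (card V) + 1)"
  have m: "m > 0" "m \<le> 1/2" "2 * m * B \<le> \<rho>"
    using B(1) \<open>\<rho> > 0\<close> by (auto simp: m_def field_simps min_def)
  have e: "e > 0" "real (card V) * e < m"
    using m by (auto simp: e_def field_simps)

  have "\<forall>v. \<exists>w. (\<forall>k. Ck_on k UNIV w) \<and> (\<forall>x. w x \<ge> 0) \<and> (\<forall>x\<in>X. \<bar>w x - c v x\<bar> < e) \<and>
      (\<forall>a\<in>F. w a = c v a) \<and> (\<forall>x\<in>X. c v x = 0 \<longrightarrow> (\<exists>W. open W \<and> x \<in> W \<and> (\<forall>y\<in>W. w y = 0)))"
    by (rule allI, rule smooth_approximation_vanishing_near_zeros[OF X c_cont c_nonneg F e(1)])
  from choice[OF this] obtain w where w: "\<And>v k. Ck_on k UNIV (w v)" "\<And>v x. w v x \<ge> 0"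
    "\<And>v x. x \<in> X \<Longrightarrow> \<bar>w v x - c v x\<bar> < e" "\<And>v a. a \<in> F \<Longrightarrow> w v a = c v a"
    "\<And>v x. x \<in> X \<Longrightarrow> c v x = 0 \<Longrightarrow> \<exists>W. open W \<and> x \<in> W \<and> (\<forall>y\<in>W. w v y = 0)"
    by blast
  define s where "s = (\<lambda>y. \<Sum>v\<in>V. w v y)"
  define h where "h = (\<lambda>y. inverse (s y) *\<^sub>R (\<Sum>v\<in>V. w v y *\<^sub>R v))"
  have Cs: "Ck_on k UNIV s" for k unfolding s_def by (intro Ck_on_sum w open_UNIV)
  have err: "(\<Sum>v\<in>V. \<bar>w v x - c v x\<bar>) \<le> real (card V) * e" if "x \<in> X" for x
    using sum_bounded_above[of V "\<lambda>v. \<bar>w v x - c v x\<bar>" e] w(3)[OF that] by (simp add: less_imp_le)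
  have s_half: "s x > 1/2" if "x \<in> X" for x
  proof -
    have "\<bar>s x - 1\<bar> \<le> (\<Sum>v\<in>V. \<bar>w v x - c v x\<bar>)"
      unfolding c_sum(1)[OF that, symmetric] s_def sum_subtractf[symmetric] by (rule sum_abs)
    then show ?thesis using err[OF that] e m by linarith
  qed
  show ?thesis
  proof (intro exI[of _ h] conjI ballI)
    show "dist (h x) (g x) < \<rho>" if x: "x \<in> X" for x
    proof -
      have sx: "s x > 1/2" using s_half[OF x] .
      \<comment> \<open>the coordinates \<open>c v x\<close> contribute nothing, as \<open>g x\<close> is their barycentre\<close>
      have "(\<Sum>v\<in>V. (w v x - c v x) *\<^sub>R (v - g x)) = s x *\<^sub>R (h x - g x)"
      proof -
        have "(\<Sum>v\<in>V. (w v x - c v x) *\<^sub>R (v - g x)) =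
          ((\<Sum>v\<in>V. w v x *\<^sub>R v) - s x *\<^sub>R g x) - ((\<Sum>v\<in>V. c v x *\<^sub>R v) - (\<Sum>v\<in>V. c v x) *\<^sub>R g x)"
          by (simp add: s_def algebra_simps sum_subtractf sum.distrib scaleR_sum_left)
        then show ?thesis using sx by (simp add: c_sum[OF x] h_def scaleR_diff_right)
      qed
      then have "s x * norm (h x - g x) = norm (\<Sum>v\<in>V. (w v x - c v x) *\<^sub>R (v - g x))"
        using sx by simp
      also have "\<dots> \<le> (\<Sum>v\<in>V. \<bar>w v x - c v x\<bar> * B)"
        by (rule sum_norm_le) (use B(2)[OF _ x] in \<open>auto intro: mult_left_mono\<close>)
      also have "\<dots> \<le> (real (card V) * e) * B"
        unfolding sum_distrib_right[symmetric] using err[OF x] B(1) by (intro mult_right_mono) auto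
      also have "\<dots> < m * B" using e(2) B(1) by (intro mult_strict_right_mono)
      finally have 1: "s x * norm (h x - g x) < m * B" .
      have 2: "(1/2) * norm (h x - g x) \<le> s x * norm (h x - g x)"
        using sx by (intro mult_right_mono) auto
      have "norm (h x - g x) < 2 * m * B" using 1 2 by linarith
      then show ?thesis using m(3) by (simp add: dist_norm)
    qed
    show "h a = g a" if "a \<in> F" for a
      using c_sum[of a] w(4)[OF that] F that by (simp add: h_def s_def subset_iff)
    show "\<exists>W. open W \<and> x \<in> W \<and> (\<forall>k. Ck_on k W h) \<and> (\<forall>S\<in>L. g x \<in> S \<longrightarrow> (\<forall>y\<in>W. h y \<in> S))"
      if x: "x \<in> X" for x
    proof -
      obtain N where N: "\<And>v. c v x = 0 \<Longrightarrow> open (N v)" "\<And>v. c v x = 0 \<Longrightarrow> x \<in> N v"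
        "\<And>v y. c v x = 0 \<Longrightarrow> y \<in> N v \<Longrightarrow> w v y = 0"
        using w(5)[OF x] by metis
      define W where "W = s -` {0<..} \<inter> (\<Inter>v\<in>{v \<in> V. c v x = 0}. N v)"
      have oW: "open W" unfolding W_def
        by (intro open_Int open_vimage Ck_on_imp_continuous_on[OF Cs[of 0]] open_greaterThan
            open_INT) (use finV N in auto)
      have xW: "x \<in> W" using N s_half[OF x] by (auto simp: W_def)
      have sW: "s y > 0" if "y \<in> W" for y using that by (auto simp: W_def)
      have "Ck_on k W h" for k
        unfolding h_def
        by (intro Ck_on_scaleR Ck_on_inverse Ck_on_sum oW Ck_on_const Ck_on_subset[OF w(1)] Ck_on_subset[OF Cs])
           (auto dest: sW)
      moreover have "h y \<in> S" if S: "S \<in> L" "g x \<in> S" and y: "y \<in> W" for S y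
      proof -
        have SV: "vertices S \<subseteq> V" using in_K[OF x] S by (auto simp: V_def)
        have w0: "w v y = 0" if "v \<in> V - vertices S" for v
          using that y c_outside[OF S] N(3)[of v y] by (auto simp: W_def)
        have "s y = (\<Sum>v\<in>vertices S. w v y)"
          unfolding s_def by (intro sum.mono_neutral_right finV SV) (simp add: w0)
        then have one: "(\<Sum>v\<in>vertices S. inverse (s y) * w v y) = 1"
          using sW[OF y] by (simp add: sum_distrib_left[symmetric])
        have "(\<Sum>v\<in>V. w v y *\<^sub>R v) = (\<Sum>v\<in>vertices S. w v y *\<^sub>R v)"
          by (intro sum.mono_neutral_right finV SV) (simp add: w0)
        then have "h y = inverse (s y) *\<^sub>R (\<Sum>v\<in>vertices S. w v y *\<^sub>R v)"
          unfolding h_def by (rule arg_cong)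
        also have "\<dots> = (\<Sum>v\<in>vertices S. (inverse (s y) * w v y) *\<^sub>R v)"
          by (simp add: scaleR_sum_right)
        also have "\<dots> \<in> S"
          using complex_vertices[OF S(1)] hull_inc[of _ "vertices S" convex] compact_simplex_in_complex(2)[OF S(1)]
            w(2) sW[OF y]
          by (intro convex_sum one) auto
        finally show ?thesis .
      qed
      ultimately show ?thesis using oW xW by (intro exI[of _ W]) simp
    qed
  qed
qed

end

text \<open>The approximation \<open>\<Psi> \<circ> h\<close> is close to \<open>f = \<Psi> \<circ> g\<close> by uniform continuity of \<open>\<Psi>\<close> on \<open>\<Union>K\<close>, the
  union of the finitely many simplices that meet the compact set \<open>g ` X\<close>; it contains \<open>h x\<close> too,
  because \<open>h x\<close> lies in every simplex through \<open>g x\<close>. This also makes the straight-line homotopy possible.\<close>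

lemma triangulable_smooth_approximation:
  fixes Y :: "'b::euclidean_space set" and f :: "'a::euclidean_space \<Rightarrow> 'b"
  assumes Y: "weakly_Cr_triangulable TYPE('v::euclidean_space) r Y"
    and X: "compact X" and f: "continuous_on X f" "f ` X \<subseteq> Y"
    and F: "finite F" "F \<subseteq> X" and "e > 0"
  shows "\<exists>g. Cr_map r X Y g \<and> (\<forall>x\<in>X. dist (g x) (f x) < e) \<and> (\<forall>a\<in>F. g a = f a) \<and>
    homotopic_with_canon (\<lambda>h. \<forall>a\<in>F. h a = f a) X Y f g"
proof -
  obtain L :: "'v set set" and \<Psi> \<Psi>' where L: "locally_finite_simplicial_complex L"
    and hom: "homeomorphism (\<Union>L) Y \<Psi> \<Psi>'" and Cr: "\<forall>S\<in>L. Cr_map r S Y \<Psi>"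
    using Y unfolding weakly_Cr_triangulable_def by blast
  have \<Psi>_cont: "continuous_on (\<Union>L) \<Psi>" by (rule homeomorphism_cont1[OF hom])
  have \<Psi>_in: "\<Psi> z \<in> Y" if "z \<in> \<Union>L" for z
    unfolding homeomorphism_image1[OF hom, symmetric] using that by (rule imageI)
  define g where "g = (\<lambda>x. \<Psi>' (f x))"
  have fY: "f x \<in> Y" if "x \<in> X" for x using f(2) that by auto
  have gL: "g ` X \<subseteq> \<Union>L"
    unfolding g_def homeomorphism_image2[OF hom, symmetric] by (intro image_subsetI imageI fY)
  have \<Psi>g: "\<Psi> (g x) = f x" if "x \<in> X" for x
    using homeomorphism_apply2[OF hom fY[OF that]] by (simp add: g_def)
  have g: "continuous_on X g"
    unfolding g_def by (rule continuous_on_compose2[OF homeomorphism_cont2[OF hom] f])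
  define K where "K = {S \<in> L. S \<inter> g ` X \<noteq> {}}"
  have "finite K" unfolding K_def
    by (rule finite_simplices_meeting_compact[OF L compact_continuous_image[OF g X] gL])
  then have "compact (\<Union>K)"
    by (rule compact_Union) (rule compact_simplex_in_complex(1)[OF L], simp add: K_def)
  moreover have "\<Union>K \<subseteq> \<Union>L" by (rule Union_mono) (auto simp: K_def)
  then have "continuous_on (\<Union>K) \<Psi>" by (rule continuous_on_subset[OF \<Psi>_cont])
  ultimately have unif: "uniformly_continuous_on (\<Union>K) \<Psi>" by (rule compact_uniformly_continuous[rotated])
  have "\<forall>d>0. \<exists>\<rho>>0. \<forall>z\<in>\<Union>K. \<forall>z'\<in>\<Union>K. dist z' z < \<rho> \<longrightarrow> dist (\<Psi> z') (\<Psi> z) < d"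
    using unif unfolding uniformly_continuous_on_def .
  from this[THEN spec, THEN mp, OF \<open>e > 0\<close>] obtain \<rho> where \<rho>: "\<rho> > 0"
    "\<forall>z\<in>\<Union>K. \<forall>z'\<in>\<Union>K. dist z' z < \<rho> \<longrightarrow> dist (\<Psi> z') (\<Psi> z) < e"
    by (elim exE conjE)
  from smooth_approximation_in_complex[OF L X g gL F \<rho>(1)] obtain h
    where "\<forall>x\<in>X. dist (h x) (g x) < \<rho>" "\<forall>a\<in>F. h a = g a"
      "\<forall>x\<in>X. \<exists>W. open W \<and> x \<in> W \<and> (\<forall>k. Ck_on k W h) \<and> (\<forall>S\<in>L. g x \<in> S \<longrightarrow> (\<forall>y\<in>W. h y \<in> S))"
    by (elim exE conjE)
  note h = this[rule_format]
  have in_simplex: "\<exists>S. S \<in> L \<and> g x \<in> S" if "x \<in> X" for x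
    using subsetD[OF gL imageI[OF that]] by (elim UnionE) (intro exI conjI)
  have simplex: "\<exists>S. S \<in> L \<and> g x \<in> S \<and> h x \<in> S" if "x \<in> X" for x
  proof -
    from in_simplex[OF that] obtain S where "S \<in> L" "g x \<in> S" by (elim exE conjE)
    moreover from h(3)[OF that] obtain W
      where "x \<in> W" "\<forall>S\<in>L. g x \<in> S \<longrightarrow> (\<forall>y\<in>W. h y \<in> S)" by (elim exE conjE)
    ultimately show ?thesis by (intro exI[of _ S] conjI) (assumption | simp)+
  qed
  have local: "\<exists>W. open W \<and> x \<in> W \<and> (\<forall>k. enat k \<le> r \<longrightarrow> Ck_on k W (\<lambda>x. \<Psi> (h x)))" if x: "x \<in> X" for x
  proof -
    from in_simplex[OF x] obtain S where S: "S \<in> L" "g x \<in> S" by (elim exE conjE)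
    from h(3)[OF x] obtain W where W: "open W" "x \<in> W" "\<forall>k. Ck_on k W h"
      and WL: "\<forall>S\<in>L. g x \<in> S \<longrightarrow> (\<forall>y\<in>W. h y \<in> S)" by (elim exE conjE)
    have WS: "h y \<in> S" if "y \<in> W" for y using WL[THEN bspec, OF S(1), THEN mp, OF S(2)] that by (rule bspec)
    from bspec[OF Cr S(1)] obtain U G
      where UG: "open U" "closedin (top_of_set U) S" "Cr_on r U G" "\<forall>z\<in>S. \<Psi> z = G z"
      unfolding Cr_map_def by (elim exE conjE)
    have "Ck_on k W (\<lambda>x. \<Psi> (h x))" if "enat k \<le> r" for k
    proof (rule Ck_on_cong[OF W(1)])
      show "Ck_on k W (\<lambda>x. G (h x))"
      proof (rule Ck_on_compose[OF W(1) UG(1) _ spec[OF W(3)]])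
        show "h ` W \<subseteq> U" using WS by (intro image_subsetI subsetD[OF closedin_imp_subset[OF UG(2)]])
        show "Ck_on k U G" using UG(3) that by (simp add: Cr_on_def)
      qed
      show "G (h y) = \<Psi> (h y)" if "y \<in> W" for y using bspec[OF UG(4) WS[OF that]] by simp
    qed
    then show ?thesis using W(1,2) by (intro exI[of _ W]) simp
  qed
  then have "\<forall>x\<in>X. \<exists>W. open W \<and> x \<in> W \<and> (\<forall>k. enat k \<le> r \<longrightarrow> Ck_on k W (\<lambda>x. \<Psi> (h x)))"
    by (rule ballI)
  from bchoice[OF this] obtain W where
    "\<forall>x\<in>X. open (W x) \<and> x \<in> W x \<and> (\<forall>k. enat k \<le> r \<longrightarrow> Ck_on k (W x) (\<lambda>x. \<Psi> (h x)))"
    by (elim exE)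
  then have W: "\<And>x. x \<in> X \<Longrightarrow> open (W x)" "\<And>x. x \<in> X \<Longrightarrow> x \<in> W x"
    "\<And>x k. x \<in> X \<Longrightarrow> enat k \<le> r \<Longrightarrow> Ck_on k (W x) (\<lambda>x. \<Psi> (h x))" by simp_all
  show ?thesis
  proof (intro exI[of _ "\<lambda>x. \<Psi> (h x)"] conjI ballI)
    show "Cr_map r X Y (\<lambda>x. \<Psi> (h x))"
      unfolding Cr_map_def
    proof (intro conjI exI ballI)
      show "(\<lambda>x. \<Psi> (h x)) ` X \<subseteq> Y"
      proof (rule image_subsetI)
        fix x assume "x \<in> X"
        from simplex[OF this] obtain S where "S \<in> L" "h x \<in> S" by (elim exE conjE)
        then show "\<Psi> (h x) \<in> Y" by (intro \<Psi>_in UnionI)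
      qed
      show "open (\<Union>x\<in>X. W x)" using W by auto
      show "closedin (top_of_set (\<Union>x\<in>X. W x)) X"
        by (intro closed_subset compact_imp_closed X subsetI UN_I) (auto intro: W(2))
      show "Cr_on r (\<Union>x\<in>X. W x) (\<lambda>x. \<Psi> (h x))"
        unfolding Cr_on_def
      proof (intro allI impI Ck_on_local)
        fix k y assume k: "enat k \<le> r" and "y \<in> (\<Union>x\<in>X. W x)"
        then obtain x where "x \<in> X" "y \<in> W x" by auto
        then show "\<exists>V. open V \<and> y \<in> V \<and> Ck_on k V (\<lambda>x. \<Psi> (h x))"
          using W(1,3) k by (intro exI[of _ "W x"]) simp
      qed
    qed simp
    show "dist (\<Psi> (h x)) (f x) < e" if "x \<in> X" for x
    proof -
      from simplex[OF that] obtain S where "S \<in> L" "g x \<in> S" "h x \<in> S" by (elim exE conjE)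
      then have "g x \<in> \<Union>K" "h x \<in> \<Union>K" using that by (auto simp: K_def)
      then show ?thesis using \<rho>(2)[THEN bspec, THEN bspec, THEN mp, OF _ _ h(1)[OF that]] \<Psi>g[OF that] by (simp only:)
    qed
    show "\<Psi> (h a) = f a" if "a \<in> F" for a using h(2)[OF that] \<Psi>g F that by auto
    have h_cont: "continuous_on X h"
    proof (rule continuous_at_imp_continuous_on, rule ballI)
      fix x assume "x \<in> X"
      from h(3)[OF this] obtain W where W: "open W" "x \<in> W" "\<forall>k. Ck_on k W h" by (elim exE conjE)
      then show "isCont h x"
        using Ck_on_imp_continuous_on[OF spec[OF W(3), of 0]] by (simp add: continuous_on_eq_continuous_at)
    qed
    \<comment> \<open>the image under \<open>\<Psi>\<close> of the straight-line homotopy\<close>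
    define H where "H = (\<lambda>(t, x). \<Psi> ((1 - t) *\<^sub>R g x + t *\<^sub>R h x))"
    have seg: "(1 - t) *\<^sub>R g x + t *\<^sub>R h x \<in> \<Union>L" if "t \<in> {0..1}" "x \<in> X" for t x
    proof -
      from simplex[OF that(2)] obtain S where S: "S \<in> L" "g x \<in> S" "h x \<in> S" by (elim exE conjE)
      then have "(1 - t) *\<^sub>R g x + t *\<^sub>R h x \<in> S"
        using that compact_simplex_in_complex(2)[OF L S(1)] by (intro convexD) auto
      then show ?thesis using S by auto
    qed
    have "continuous_on ({0..1} \<times> X) H"
      unfolding H_def case_prod_beta
      by (rule continuous_on_compose2[OF \<Psi>_cont])
         (auto intro!: continuous_intros continuous_on_compose2[OF g] continuous_on_compose2[OF h_cont] seg[simplified])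
    moreover have "H ` ({0..1} \<times> X) \<subseteq> Y"
      unfolding H_def using \<Psi>_in[OF seg] by (auto simp del: atLeastAtMost_iff)
    ultimately have H_cont:
      "continuous_map (prod_topology (top_of_set {0..1}) (top_of_set X)) (top_of_set Y) H"
      by (simp add: image_subset_iff_funcset)
    have H_fixed: "H (t, a) = f a" if "a \<in> F" for t a
      using h(2)[OF that] \<Psi>g[OF subsetD[OF F(2) that]]
      by (simp add: H_def scaleR_add_left[symmetric])
    have H_ends: "H (0, x) = f x" "H (1, x) = \<Psi> (h x)" if "x \<in> X" for x
      using \<Psi>g[OF that] by (simp_all add: H_def)
    have insens: "(\<forall>a\<in>F. h1 a = f a) \<longleftrightarrow> (\<forall>a\<in>F. h2 a = f a)"
      if "\<And>x. x \<in> topspace (top_of_set X) \<Longrightarrow> h1 x = h2 x" for h1 h2 :: "'a \<Rightarrow> 'b"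
      by (rule ball_cong[OF refl]) (use that F(2) in \<open>simp add: subset_iff\<close>)
    show "homotopic_with_canon (\<lambda>h. \<forall>a\<in>F. h a = f a) X Y f (\<lambda>x. \<Psi> (h x))"
    proof (rule iffD2[OF homotopic_with])
      show "(\<forall>a\<in>F. h1 a = f a) \<longleftrightarrow> (\<forall>a\<in>F. h2 a = f a)"
        if "\<And>x. x \<in> topspace (top_of_set X) \<Longrightarrow> h1 x = h2 x" for h1 h2 :: "'a \<Rightarrow> 'b"
        using that by (rule insens)
    qed (intro exI[of _ H] conjI H_cont ballI; simp only: topspace_euclidean_subtopology H_ends H_fixed)
  qed
qed

text \<open>A path is handled with \<open>F = {0, 1}\<close>, a strong neighbourhood being a uniform one on the compact
  unit interval. A homotopy class is handled with \<open>F = {north_pole}\<close>; only the homotopy matters there, so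
  any error bound will do.\<close>

theorem corollary1p22:
  fixes Y :: "(real ^ 'n) set" and y0 :: "real ^ 'n" and r :: enat
  assumes "r \<ge> 1"
    and "weakly_Cr_triangulable TYPE(real ^ 'q) r Y"
    and "y0 \<in> Y"
  shows "(\<forall>\<gamma> :: real \<Rightarrow> real ^ 'n. path \<gamma> \<and> path_image \<gamma> \<subseteq> Y \<longrightarrow>
           (\<forall>V \<in> strong_C0_nhds {0..1} Y \<gamma>.
              \<exists>\<alpha>\<in>V. Cr_map r {0..1} Y \<alpha> \<and> \<alpha> 0 = \<gamma> 0 \<and> \<alpha> 1 = \<gamma> 1)) \<and>
         (\<forall>c \<in> (homotopy_group_carrier Y y0 :: ((real ^ 'p) \<times> real \<Rightarrow> real ^ 'n) set set).
            \<exists>f\<in>c. Cr_map r std_sphere Y f)"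
proof (intro conjI allI impI ballI)
  fix \<gamma> :: "real \<Rightarrow> real ^ 'n" and V
  assume \<gamma>: "path \<gamma> \<and> path_image \<gamma> \<subseteq> Y" and "V \<in> strong_C0_nhds {0..1} Y \<gamma>"
  then obtain \<epsilon> where \<epsilon>: "continuous_on {0..1} \<epsilon>" "\<And>x. x \<in> {0..1} \<Longrightarrow> \<epsilon> x > 0"
    and V: "V = {g \<in> C0_maps {0..1} Y. \<forall>x\<in>{0..1}. norm (g x - \<gamma> x) < \<epsilon> x}"
    unfolding strong_C0_nhds_def by blast
  obtain x0 where x0: "x0 \<in> {0..1}" "\<And>x. x \<in> {0..1} \<Longrightarrow> \<epsilon> x0 \<le> \<epsilon> x"
    using continuous_attains_inf[OF _ _ \<epsilon>(1)] by auto
  have \<gamma>': "continuous_on {0..1} \<gamma>" "\<gamma> ` {0..1} \<subseteq> Y" using \<gamma> by (auto simp: path_def path_image_def)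
  have "\<exists>\<alpha>. Cr_map r {0..1} Y \<alpha> \<and> (\<forall>x\<in>{0..1}. dist (\<alpha> x) (\<gamma> x) < \<epsilon> x0) \<and>
      (\<forall>a\<in>{0, 1}. \<alpha> a = \<gamma> a) \<and> homotopic_with_canon (\<lambda>h. \<forall>a\<in>{0, 1}. h a = \<gamma> a) {0..1} Y \<gamma> \<alpha>"
    by (rule triangulable_smooth_approximation[OF assms(2) _ \<gamma>']) (use \<epsilon>(2) x0(1) in auto)
  then obtain \<alpha> where \<alpha>: "Cr_map r {0..1} Y \<alpha>" "\<forall>x\<in>{0..1}. dist (\<alpha> x) (\<gamma> x) < \<epsilon> x0"
    "\<forall>a\<in>{0, 1}. \<alpha> a = \<gamma> a"
    "homotopic_with_canon (\<lambda>h. \<forall>a\<in>{0, 1}. h a = \<gamma> a) {0..1} Y \<gamma> \<alpha>"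
    by (elim exE conjE)
  have "\<alpha> \<in> V"
    using \<alpha>(2) x0(2) homotopic_with_imp_continuous[OF \<alpha>(4)] homotopic_with_imp_subset2[OF \<alpha>(4)]
    by (fastforce simp: V C0_maps_def dist_norm)
  then show "\<exists>\<alpha>\<in>V. Cr_map r {0..1} Y \<alpha> \<and> \<alpha> 0 = \<gamma> 0 \<and> \<alpha> 1 = \<gamma> 1" using \<alpha>(1,3) by auto
next
  fix c :: "((real ^ 'p) \<times> real \<Rightarrow> real ^ 'n) set"
  assume "c \<in> homotopy_group_carrier Y y0"
  then obtain f where f: "f \<in> pointed_sphere_maps Y y0" and c: "c = pointed_homotopy Y y0 `` {f}"
    unfolding homotopy_group_carrier_def by (auto elim: quotientE)
  have f': "continuous_on std_sphere f" "f ` std_sphere \<subseteq> Y" "f north_pole = y0"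
    using f by (auto simp: pointed_sphere_maps_def C0_maps_def)
  have N: "(north_pole :: (real ^ 'p) \<times> real) \<in> std_sphere"
    by (simp add: north_pole_def std_sphere_def norm_Pair)
  have "compact (std_sphere :: ((real ^ 'p) \<times> real) set)" by (simp add: std_sphere_def)
  from triangulable_smooth_approximation[OF assms(2) this f'(1,2), of "{north_pole}" 1] N f'(3)
  obtain g where g: "Cr_map r std_sphere Y g" "g north_pole = y0"
    "homotopic_with_canon (\<lambda>h. h north_pole = y0) std_sphere Y f g" by (simp, elim exE conjE)
  have "g \<in> pointed_sphere_maps Y y0"
    using g(2) homotopic_with_imp_continuous[OF g(3)] homotopic_with_imp_subset2[OF g(3)]
    by (auto simp: pointed_sphere_maps_def C0_maps_def)
  then have "g \<in> c" using f g(3) by (auto simp: c pointed_homotopy_def)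
  then show "\<exists>f\<in>c. Cr_map r std_sphere Y f" using g(1) by blast
qed

end
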